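(* Let $k$ be an odd integer and let $l\ge 2$ be an even integer with $k\ge 2l+1$. If $C\in\mathcal{F}\left(\frac{3k}{2}+\frac{l+1}{2},\,k,\,k+l\right)$ is symmetric, then $|C|\le 4k+2l$.
   Context: $I(d)$ is the graph of the $d$-dimensional hypercube (vertices are binary vectors of length $d$; edges join vectors differing in exactly one position). For a graph $G$, $d_G(x,y)$ is the graph distance in $G$. A circuit in $I(d)$ is a simple cycle $C=(x_1,\ldots,x_N)$ in $I(d)$; its length is $|C|=N$. A $(d,k)$ circuit code (circuit code of spread $k$ in dimension $d$) is a circuit $C$ in $I(d)$ such that for all vertices $x,y$ of $C$, $d_{I(d)}(x,y)<k$ implies $d_C(x,y)=d_{I(d)}(x,y)$. The transition sequence of $C$ is $T=(\tau_1,\ldots,\tau_N)$, where $\tau_i\in\{1,\ldots,d\}$ is the position in which $x_i$ and $x_{i+1}$ differ (indices mod $N$). A segment of $T$ is a subsequence of cyclically consecutive elements of $T$. The maximum bit run $\phi(C)$ is the length of the longest segment of $T$ in which no transition is repeated. $\mathcal{F}(d,k,r)$ is the set of $(d,k)$ circuit codes $C$ with $\phi(C)\ge r$. A circuit code is symmetric if its transition sequence satisfies $\tau_i=\tau_{i+N/2}$ for $1\le i\le N/2$ ($N$ is always even since $I(d)$ is bipartite). *)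

theory Defs
  imports Complex_Main
begin

text \<open>A graph is represented by its symmetric edge relation. Both graphs used below
  (the hypercube and a cycle) are connected, so the minimum always exists on their
  vertices.\<close>

definition graph_dist :: "('v \<times> 'v) set \<Rightarrow> 'v \<Rightarrow> 'v \<Rightarrow> nat" where
  "graph_dist E x y = (LEAST n. (x, y) \<in> E ^^ n)"

text \<open>Positions of a binary vector are numbered \<open>0, \<dots>, d - 1\<close>, and the members of a
  circuit and of its transition sequence \<open>0, \<dots>, N - 1\<close>.\<close>

definition cube_verts :: "nat \<Rightarrow> bool list set" where
  "cube_verts d = {x. length x = d}"

definition cube_edges :: "nat \<Rightarrow> (bool list \<times> bool list) set" where
  "cube_edges d =
     {(x, y). x \<in> cube_verts d \<and> y \<in> cube_verts d \<and> (\<exists>!p. p < d \<and> x ! p \<noteq> y ! p)}"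

definition cyc_succ :: "'v list \<Rightarrow> nat \<Rightarrow> 'v" where
  "cyc_succ C i = C ! ((i + 1) mod length C)"

definition cycle_edges :: "'v list \<Rightarrow> ('v \<times> 'v) set" where
  "cycle_edges C =
     {(C ! i, cyc_succ C i) |i. i < length C} \<union> {(cyc_succ C i, C ! i) |i. i < length C}"

definition circuit :: "nat \<Rightarrow> bool list list \<Rightarrow> bool" where
  "circuit d C \<longleftrightarrow>
     length C \<ge> 3 \<and> distinct C \<and> set C \<subseteq> cube_verts d \<and> cycle_edges C \<subseteq> cube_edges d"

definition circuit_code :: "nat \<Rightarrow> nat \<Rightarrow> bool list list \<Rightarrow> bool" where
  "circuit_code d k C \<longleftrightarrow>
     circuit d C \<and>
     (\<forall>x \<in> set C. \<forall>y \<in> set C.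
        graph_dist (cube_edges d) x y < k \<longrightarrow>
        graph_dist (cycle_edges C) x y = graph_dist (cube_edges d) x y)"

definition transition_seq :: "bool list list \<Rightarrow> nat list" where
  "transition_seq C =
     map (\<lambda>i. THE p. p < length (C ! i) \<and> C ! i ! p \<noteq> cyc_succ C i ! p) [0..<length C]"

definition segments :: "'a list \<Rightarrow> 'a list set" where
  "segments T = {take m (rotate i T) |i m. m \<le> length T}"

definition max_bit_run :: "bool list list \<Rightarrow> nat" where
  "max_bit_run C = Max {length s |s. s \<in> segments (transition_seq C) \<and> distinct s}"

definition circuit_codes :: "nat \<Rightarrow> nat \<Rightarrow> nat \<Rightarrow> bool list list set" where
  "circuit_codes d k r = {C. circuit_code d k C \<and> max_bit_run C \<ge> r}"

definition symmetric_code :: "bool list list \<Rightarrow> bool" where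
  "symmetric_code C \<longleftrightarrow>
     (\<forall>i < length C div 2.
        transition_seq C ! i = transition_seq C ! (i + length C div 2))"

end

theory Submission
  imports Defs
begin

text \<open>
  Identify vertices with subsets of the coordinates and let \<open>n = N/2\<close>. By symmetry the set \<open>X\<close> of
  coordinates in which \<open>x\<^sub>i\<close> and \<open>x\<^bsub>i+n\<^esub>\<close> differ does not depend on \<open>i\<close>. Shortening a half turn by a
  transition in \<open>X\<close> shows \<open>|X| \<ge> k + 1\<close>. Let \<open>A\<close> be the set of the \<open>k + l\<close> transitions of a bit run,
  and suppose \<open>n > 2k + l\<close>. The rest of the half turn after the run has at least \<open>k + 1\<close> transitions
  and differs in the symmetric difference \<open>A \<triangle> X\<close>, so \<open>|A| + |X| + |A \<triangle> X| \<ge> 3k + l + 1 = 2d\<close>.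
  This sum counts \<open>A \<union> X\<close> twice, so equality holds: \<open>|X| = k + 1\<close>, \<open>|A \<triangle> X| = k\<close>, and \<open>A \<union> X\<close>
  contains all coordinates. Let \<open>a\<close> be the last transition of the run and \<open>b\<close> the next one. Then
  \<open>a \<in> X\<close>, since otherwise prepending \<open>a\<close> to the rest gives distance \<open>k - 1\<close>; \<open>b \<notin> X\<close>, since otherwise
  omitting \<open>a, b\<close> from a half turn gives \<open>k - 1\<close>; so \<open>b \<in> A - X\<close>, and omitting \<open>b\<close> from the rest
  gives \<open>k - 1\<close>, a contradiction.
\<close>

section \<open>Walks on sets\<close>

lemma sym_diff_drop:
  "x \<in> sym_diff P Q \<Longrightarrow> sym_diff (sym_diff P {x}) Q = sym_diff P Q - {x}"
  by blast

lemma sym_diff_walk_subset: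
  assumes step: "\<And>i. V (Suc i) = sym_diff (V i) {\<tau> i}"
  shows "sym_diff (V i) (V (i + t)) \<subseteq> \<tau> ` {i..<i + t}"
proof (induction t)
  case (Suc t)
  have "sym_diff (V i) (V (i + Suc t)) \<subseteq> sym_diff (V i) (V (i + t)) \<union> {\<tau> (i + t)}"
    using step[of "i + t"] by auto
  also have "\<dots> \<subseteq> \<tau> ` {i..<i + Suc t}"
    using Suc.IH by (fastforce simp: image_iff)
  finally show ?case .
qed simp

text \<open>Repeated flips may cancel, which is why \<open>sym_diff_walk_subset\<close> is only an
  inclusion; without repetition no flip is undone.\<close>

lemma sym_diff_walk_inj:
  assumes step: "\<And>i. V (Suc i) = sym_diff (V i) {\<tau> i}"
    and "inj_on \<tau> {i..<i + t}"
  shows "sym_diff (V i) (V (i + t)) = \<tau> ` {i..<i + t}"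
  using assms(2)
proof (induction t)
  case (Suc t)
  have inj: "inj_on \<tau> {i..<i + t}"
    using Suc.prems by (rule inj_on_subset) auto
  have ivl: "{i..<i + Suc t} = insert (i + t) {i..<i + t}"
    by auto
  have "\<tau> (i + t) \<notin> \<tau> ` {i..<i + t}"
    using Suc.prems unfolding ivl by (simp add: inj_on_insert)
  then show ?case
    using Suc.IH[OF inj] step[of "i + t"] unfolding ivl by auto
qed simp

text \<open>The combinatorial core, with indices unrolled over \<open>nat\<close> so that no segment
  wraps around. The spread enters through \<open>far\<close>: positions at least \<open>k\<close>
  apart both ways around a cycle of length \<open>2 * n\<close> differ in at least \<open>k\<close>
  coordinates.\<close>

lemma antipodal_walk_bound:
  fixes V :: "nat \<Rightarrow> nat set" and \<tau> :: "nat \<Rightarrow> nat"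
  assumes bound: "\<And>i. V i \<subseteq> {..<d}"
    and step: "\<And>i. V (Suc i) = sym_diff (V i) {\<tau> i}"
    and antip: "\<And>i. \<tau> (i + n) = \<tau> i"
    and turn: "\<And>i. \<tau> i \<noteq> \<tau> (Suc i)"
    and far: "\<And>i t. k \<le> t \<Longrightarrow> t + k \<le> 2 * n \<Longrightarrow> k \<le> card (sym_diff (V i) (V (i + t)))"
    and inj: "inj_on \<tau> {s..<s + (k + l)}"
    and d: "2 * d = 3 * k + l + 1"
    and k: "k \<ge> 1"
  shows "n \<le> 2 * k + l"
proof (rule ccontr)
  assume "\<not> n \<le> 2 * k + l"
  then have n: "n \<ge> 2 * k + l + 1" by simp
  define X where "X = sym_diff (V s) (V (s + n))"
  define A where "A = sym_diff (V s) (V (s + (k + l)))"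
  define e where "e = s + (k + l)"
  have fin: "finite (V i)" for i
    using bound[of i] finite_subset by blast
  have finX: "finite X" and finA: "finite A"
    using fin by (auto simp: X_def A_def)
  have shift: "sym_diff (V (Suc i)) (V (Suc i + n)) = sym_diff (V i) (V (i + n))" for i
    using step[of i] step[of "i + n"] antip[of i] by auto
  have X: "sym_diff (V (s + i)) (V (s + i + n)) = X" for i
    by (induction i) (use shift X_def in simp_all)
  \<comment> \<open>Common shape of the contradictions below: a stretch long enough for
    \<open>far\<close> whose ends differ in only \<open>k - 1\<close> coordinates.\<close>
  have no_drop: False
    if "sym_diff (V i) (V (i + t)) = Y - {x}" "x \<in> Y" "card Y = k" "finite Y" "k \<le> t" "t + k \<le> 2 * n"
    for i t x Y
    using far[OF that(5,6), of i] that(2-4) k unfolding that(1) by simp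
  have cardA: "card A = k + l"
    unfolding A_def sym_diff_walk_inj[of V \<tau>, OF step inj] using card_image[OF inj] by simp
  have "card X \<ge> k"
    unfolding X_def using far[of n s] n by simp
  moreover have "card X \<noteq> k"
  proof
    assume cX: "card X = k"
    then obtain x where "x \<in> X"
      using k by fastforce
    \<comment> \<open>A coordinate of \<open>X\<close> is flipped somewhere in the half turn;
      starting right after that flip, with the end kept at \<open>j + n\<close>, loses
      \<open>x\<close>.\<close>
    then have "x \<in> \<tau> ` {s..<s + n}"
      using sym_diff_walk_subset[of V \<tau> s n, OF step] unfolding X_def by blast
    then obtain j where j: "j \<ge> s" "x = \<tau> j"
      by auto
    have "sym_diff (V j) (V (j + n)) = X"
      using X[of "j - s"] j by simp
    then have eq: "sym_diff (V (Suc j)) (V (Suc j + (n - 1))) = X - {x}"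
      using sym_diff_drop[of x "V j" "V (j + n)"] step[of j] j \<open>x \<in> X\<close> n by simp
    show False
      by (rule no_drop[OF eq \<open>x \<in> X\<close> cX finX]) (use n in simp_all)
  qed
  ultimately have cardX: "card X \<ge> k + 1" by simp
  have W: "sym_diff (V e) (V (e + (n - (k + l)))) = sym_diff A X"
    using n by (auto simp: A_def X_def e_def)
  \<comment> \<open>At least \<open>k + 1\<close> steps remain after the run; the spare one permits
    dropping \<open>\<tau> e\<close> at the end.\<close>
  have cardW: "card (sym_diff A X) \<ge> k"
    using far[of "n - (k + l)" e] n W by simp
  have AX: "A \<union> X \<subseteq> {..<d}"
    using bound[of s] bound[of e] bound[of "s + n"] by (auto simp: A_def X_def e_def)
  have Un: "A \<union> X = (A - X) \<union> X"
    by auto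
  have cAX: "card A = card (A - X) + card (A \<inter> X)" "card X = card (X - A) + card (A \<inter> X)"
    using card_Int_Diff[OF finA, of X] card_Int_Diff[OF finX, of A] by (simp_all add: Int_commute)
  have cUn: "card (A \<union> X) = card (A - X) + card X"
    by (subst Un, rule card_Un_disjoint) (use finA finX in auto)
  have csd: "card (sym_diff A X) = card (A - X) + card (X - A)"
    by (rule card_Un_disjoint) (use finA finX in auto)
  have "card (A \<union> X) \<le> d"
    using card_mono[OF _ AX] by simp
  with cAX cUn csd cardA cardX cardW d
  have eq: "card X = k + 1" "card (sym_diff A X) = k" "card (A \<union> X) = d"
    by linarith+
  have cover: "A \<union> X = {..<d}"
    using AX eq(3) by (simp add: card_subset_eq)
  have fin_sd: "finite (sym_diff A X)"
    using finA finX by simp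
  define p where "p = e - 1"
  have p: "e = Suc p" "p \<ge> s"
    using k by (auto simp: e_def p_def)
  have "\<tau> p \<in> A"
    unfolding A_def sym_diff_walk_inj[of V \<tau>, OF step inj] using k by (auto simp: p_def e_def)
  have "\<tau> p \<in> X"
  proof (rule ccontr)
    assume "\<tau> p \<notin> X"
    with \<open>\<tau> p \<in> A\<close> have mem: "\<tau> p \<in> sym_diff A X" by blast
    \<comment> \<open>Flips are involutions, so the walk can be extended backwards over
      \<open>\<tau> p\<close> with its end fixed at \<open>s + n\<close>.\<close>
    have Vp: "V p = sym_diff (V e) {\<tau> p}"
      using step[of p] p by auto
    have pe: "p + (n - (k + l) + 1) = e + (n - (k + l))"
      using p by simp
    have "sym_diff (V p) (V (p + (n - (k + l) + 1))) = sym_diff A X - {\<tau> p}"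
      unfolding pe Vp using sym_diff_drop[OF mem[folded W]] unfolding W .
    then show False
      by (rule no_drop[OF _ mem eq(2) fin_sd]) (use n in simp_all)
  qed
  have "\<tau> e \<notin> X"
  proof
    assume "\<tau> e \<in> X"
    have ee: "Suc e + (n - 2) = p + n"
      using p n k by simp
    have Xp: "sym_diff (V p) (V (p + n)) = X"
      using X[of "p - s"] p by simp
    have Ve: "sym_diff (V e) (V (p + n)) = X - {\<tau> p}"
      using sym_diff_drop[of "\<tau> p" "V p" "V (p + n)"] step[of p] p \<open>\<tau> p \<in> X\<close> Xp by simp
    \<comment> \<open>By \<open>turn\<close> the two removed coordinates are distinct, so
      \<open>k + 1\<close> falls to \<open>k - 1\<close>.\<close>
    have "\<tau> e \<in> X - {\<tau> p}"
      using \<open>\<tau> e \<in> X\<close> turn[of p] p by simp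
    then have "sym_diff (V (Suc e)) (V (Suc e + (n - 2))) = X - {\<tau> p} - {\<tau> e}"
      unfolding ee step[of e] Ve[symmetric] by (rule sym_diff_drop)
    then show False
      by (rule no_drop) (use \<open>\<tau> e \<in> X - {\<tau> p}\<close> \<open>\<tau> p \<in> X\<close> finX eq(1) n k in simp_all)
  qed
  moreover have "\<tau> e < d"
    using step[of e] bound[of e] bound[of "Suc e"] by auto
  ultimately have mem: "\<tau> e \<in> sym_diff A X"
    using cover by auto
  have ee: "Suc e + (n - (k + l) - 1) = e + (n - (k + l))"
    using n by simp
  have "sym_diff (V (Suc e)) (V (Suc e + (n - (k + l) - 1))) = sym_diff A X - {\<tau> e}"
    unfolding ee step[of e] using sym_diff_drop[OF mem[folded W]] unfolding W .
  then show False
    by (rule no_drop[OF _ mem eq(2) fin_sd]) (use n in simp_all)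
qed

section \<open>Distances in the hypercube and in a cycle\<close>

text \<open>With vectors as sets of ones, a transition is a symmetric difference with a singleton,
  and Hamming distance is the size of a symmetric difference.\<close>

definition support :: "bool list \<Rightarrow> nat set" where
  "support x = {p. p < length x \<and> x ! p}"

lemma finite_support [simp]: "finite (support x)"
  by (simp add: support_def)

lemma sym_diff_support:
  assumes "length x = length y"
  shows "sym_diff (support x) (support y) = {p. p < length x \<and> x ! p \<noteq> y ! p}"
  using assms by (auto simp: support_def)

lemma cube_edges_iff:
  "(x, y) \<in> cube_edges d \<longleftrightarrow>
     length x = d \<and> length y = d \<and> (\<exists>p. sym_diff (support x) (support y) = {p})"
proof (cases "length x = d \<and> length y = d")
  case True
  then have "(\<exists>!p. p < d \<and> x ! p \<noteq> y ! p) \<longleftrightarrow> (\<exists>p. {p. p < d \<and> x ! p \<noteq> y ! p} = {p})"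
    unfolding Ex1_def by (intro ex_cong1) auto
  with True show ?thesis
    by (simp add: cube_edges_def cube_verts_def sym_diff_support)
qed (auto simp: cube_edges_def cube_verts_def)

text \<open>Correcting one differing coordinate at a time bounds the cube distance above by the
  Hamming distance.\<close>

lemma cube_path:
  assumes "length x = d" "length y = d"
  shows "(x, y) \<in> cube_edges d ^^ card (sym_diff (support x) (support y))"
  using assms
proof (induction "card (sym_diff (support x) (support y))" arbitrary: x)
  case 0
  then have "x = y"
    by (auto simp: sym_diff_support intro: nth_equalityI)
  with 0 show ?case by auto
next
  case (Suc m)
  then have "sym_diff (support x) (support y) \<noteq> {}"
    by (metis card.empty nat.distinct(1))
  then obtain p where p: "p < d" "x ! p \<noteq> y ! p"
    using Suc.prems by (auto simp: sym_diff_support)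
  define z where "z = x[p := y ! p]"
  have "{q. q < d \<and> x ! q \<noteq> z ! q} = {p}"
    using p Suc.prems by (auto simp: z_def nth_list_update)
  then have edge: "(x, z) \<in> cube_edges d"
    using Suc.prems by (simp add: cube_edges_iff sym_diff_support z_def)
  have "{q. q < d \<and> z ! q \<noteq> y ! q} = {q. q < d \<and> x ! q \<noteq> y ! q} - {p}"
    using p Suc.prems by (auto simp: z_def nth_list_update)
  then have "m = card (sym_diff (support z) (support y))"
    using Suc.hyps(2) Suc.prems p by (simp add: sym_diff_support z_def)
  then have "(z, y) \<in> cube_edges d ^^ m"
    using Suc.hyps(1)[of z] Suc.prems by (simp add: z_def)
  with edge show ?case
    unfolding Suc.hyps(2)[symmetric] by (rule relpow_Suc_I2)
qed

lemma cycle_path: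
  assumes "length C > 0"
  shows "(C ! (i mod length C), C ! ((i + t) mod length C)) \<in> cycle_edges C ^^ t"
proof (induction t)
  case (Suc t)
  have "(C ! ((i + t) mod length C), C ! ((i + Suc t) mod length C)) \<in> cycle_edges C"
    unfolding cycle_edges_def cyc_succ_def
    by (rule UnI1, rule CollectI, rule exI[of _ "(i + t) mod length C"])
      (use assms in \<open>simp add: mod_Suc_eq\<close>)
  with Suc.IH show ?case by auto
qed simp

text \<open>Each edge moves the index by one, forwards or backwards, modulo the length;
  \<open>q\<close> is the signed total.\<close>

lemma cycle_path_offset:
  assumes "distinct C" "i < length C" "j < length C" "(C ! i, C ! j) \<in> cycle_edges C ^^ t"
  shows "\<exists>q. \<bar>q\<bar> \<le> int t \<and> int (length C) dvd int j - int i - q"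
  using assms(3,4)
proof (induction t arbitrary: j)
  case 0
  then have "i = j"
    using assms by (simp add: nth_eq_iff_index_eq)
  then show ?case by (intro exI[of _ 0]) simp
next
  case (Suc t)
  then obtain y where y: "(C ! i, y) \<in> cycle_edges C ^^ t" "(y, C ! j) \<in> cycle_edges C"
    by auto
  have succ: "int (length C) dvd int ((m + 1) mod length C) - int m - 1" for m
    by (metis (no_types, lifting) diff_diff_eq mod_eq_dvd_iff mod_mod_trivial of_nat_1
        of_nat_add of_nat_mod)
  have "\<exists>m r. m < length C \<and> y = C ! m \<and> \<bar>r\<bar> \<le> 1 \<and> int (length C) dvd int j - int m - r"
    using y(2) unfolding cycle_edges_def
  proof (elim UnE CollectE exE conjE Pair_inject)
    fix m assume m: "y = C ! m" "C ! j = cyc_succ C m" "m < length C"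
    moreover have "(m + 1) mod length C < length C"
      using m(3) by (intro mod_less_divisor) auto
    ultimately have "j = (m + 1) mod length C"
      using assms(1) Suc.prems(1) unfolding cyc_succ_def by (simp only: nth_eq_iff_index_eq)
    with m succ[of m] show ?thesis by (intro exI[of _ m] exI[of _ 1]) simp
  next
    fix m assume m: "y = cyc_succ C m" "C ! j = C ! m" "m < length C"
    then have "j = m"
      using assms(1) Suc.prems(1) by (simp add: nth_eq_iff_index_eq)
    have "int (length C) dvd int j - int ((m + 1) mod length C) - (- 1)"
      using succ[of m] \<open>j = m\<close> by (subst dvd_minus_iff[symmetric]) (simp add: algebra_simps)
    moreover have "(m + 1) mod length C < length C"
      using m(3) by (intro mod_less_divisor) auto
    ultimately show ?thesis
      using m by (intro exI[of _ "(m + 1) mod length C"] exI[of _ "- 1"]) (simp add: cyc_succ_def)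
  qed
  then obtain m r where m: "m < length C" "y = C ! m" "\<bar>r\<bar> \<le> 1"
    and r: "int (length C) dvd int j - int m - r" by blast
  from Suc.IH[OF m(1)] y(1) m(2) obtain q
    where q: "\<bar>q\<bar> \<le> int t" "int (length C) dvd int m - int i - q" by auto
  have "int (length C) dvd int j - int i - (q + r)"
    using dvd_add[OF r q(2)] by (simp add: algebra_simps)
  then show ?case
    using q(1) m(3) by (intro exI[of _ "q + r"]) simp
qed

text \<open>For a walk of fewer than \<open>k\<close> edges with net offset \<open>q\<close>, the
  number \<open>t - q\<close> would be a multiple of the length strictly between 0 and the
  length.\<close>

lemma cycle_dist_ge:
  assumes "distinct C" "length C > 0" "k \<le> t" "t + k \<le> length C"
  shows "k \<le> graph_dist (cycle_edges C) (C ! (i mod length C)) (C ! ((i + t) mod length C))"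
    (is "k \<le> ?g")
proof (rule ccontr)
  assume "\<not> k \<le> ?g"
  have "(C ! (i mod length C), C ! ((i + t) mod length C)) \<in> cycle_edges C ^^ ?g"
    unfolding graph_dist_def by (rule LeastI) (rule cycle_path[OF assms(2)])
  with assms obtain q where q: "\<bar>q\<bar> \<le> int ?g"
    and dvd: "int (length C) dvd int ((i + t) mod length C) - int (i mod length C) - q"
    using cycle_path_offset[of C "i mod length C" "(i + t) mod length C"] by auto
  have "int t - q = (int ((i + t) mod length C) - int (i mod length C) - q)
      + int (length C) * (int ((i + t) div length C) - int (i div length C))"
    by (simp add: of_nat_mod of_nat_div minus_mult_div_eq_mod[symmetric] algebra_simps)
  then have "int (length C) dvd int t - q"
    using dvd by (simp only: dvd_add_left_iff dvd_triv_left)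
  moreover have "0 < int t - q" "int t - q < int (length C)"
    using q \<open>\<not> k \<le> ?g\<close> assms by linarith+
  ultimately show False
    using zdvd_not_zless by blast
qed

text \<open>A Hamming distance below \<open>k\<close> would force a cycle distance below
  \<open>k\<close>, but both arcs have at least \<open>k\<close> edges.\<close>

lemma circuit_code_far:
  assumes "circuit_code d k C" "k \<le> t" "t + k \<le> length C"
  shows "k \<le> card (sym_diff (support (C ! (i mod length C)))
                             (support (C ! ((i + t) mod length C))))"
    (is "k \<le> card (sym_diff (support ?x) (support ?y))")
proof (rule ccontr)
  assume near: "\<not> ?thesis"
  have C: "distinct C" "length C > 0" "set C \<subseteq> cube_verts d"
    using assms(1) by (auto simp: circuit_code_def circuit_def)
  then have xy: "?x \<in> set C" "?y \<in> set C"
    by simp_all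
  then have "length ?x = d" "length ?y = d"
    using C(3) by (auto simp: cube_verts_def)
  then have "graph_dist (cube_edges d) ?x ?y \<le> card (sym_diff (support ?x) (support ?y))"
    unfolding graph_dist_def by (intro Least_le cube_path)
  then have "graph_dist (cube_edges d) ?x ?y < k"
    using near by simp
  then have "graph_dist (cycle_edges C) ?x ?y < k"
    using assms(1) xy by (auto simp: circuit_code_def)
  then show False
    using cycle_dist_ge[OF C(1,2) assms(2,3), of i] by simp
qed

section \<open>Transition sequences\<close>

lemma length_transition_seq [simp]: "length (transition_seq C) = length C"
  by (simp add: transition_seq_def)

lemma support_transition:
  assumes "circuit d C"
  shows "support (C ! (Suc i mod length C)) =
    sym_diff (support (C ! (i mod length C))) {transition_seq C ! (i mod length C)}"
proof -
  let ?m = "i mod length C"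
  have m: "?m < length C"
    using assms by (auto simp: circuit_def intro: mod_less_divisor)
  have suc: "C ! (Suc i mod length C) = cyc_succ C ?m"
    by (simp add: cyc_succ_def mod_Suc_eq)
  have "(C ! ?m, cyc_succ C ?m) \<in> cycle_edges C"
    using m by (auto simp: cycle_edges_def)
  then have "(C ! ?m, cyc_succ C ?m) \<in> cube_edges d"
    using assms by (auto simp: circuit_def)
  then obtain p where len: "length (C ! ?m) = d" "length (cyc_succ C ?m) = d"
    and p: "sym_diff (support (C ! ?m)) (support (cyc_succ C ?m)) = {p}"
    by (auto simp: cube_edges_iff)
  then have "{p. p < d \<and> C ! ?m ! p \<noteq> cyc_succ C ?m ! p} = {p}"
    by (simp add: sym_diff_support)
  then have "transition_seq C ! ?m = p"
    using m len by (auto simp: transition_seq_def intro!: the_equality)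
  with p suc show ?thesis
    by auto
qed

text \<open>Each transition changes the number of ones by one, and a full turn restores it.\<close>

lemma even_length_circuit:
  assumes "circuit d C"
  shows "even (length C)"
proof -
  let ?V = "\<lambda>i. support (C ! (i mod length C))"
  have "even (card (?V i)) = even (card (?V 0) + i)" for i
  proof (induction i)
    case (Suc i)
    let ?p = "transition_seq C ! (i mod length C)"
    have "?V (Suc i) = (if ?p \<in> ?V i then ?V i - {?p} else insert ?p (?V i))"
      using support_transition[OF assms, of i] by auto
    then have "card (?V (Suc i)) + 1 = card (?V i) \<or> card (?V (Suc i)) = card (?V i) + 1"
      using card_Suc_Diff1[OF finite_support, of ?p] by auto
    with Suc.IH show ?case
      by (metis add_Suc_right even_Suc Suc_eq_plus1)
  qed simp
  from this[of "length C"] show ?thesis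
    by (simp split: if_splits) blast
qed

text \<open>Two equal transitions in a row would return to the vertex two steps before, impossible
  in a cycle of length at least 3.\<close>

lemma transition_seq_turn:
  assumes "circuit d C"
  shows "transition_seq C ! (i mod length C) \<noteq> transition_seq C ! (Suc i mod length C)"
proof
  let ?N = "length C"
  assume eq: "transition_seq C ! (i mod ?N) = transition_seq C ! (Suc i mod ?N)"
  have N: "?N \<ge> 3" and C: "distinct C" "set C \<subseteq> cube_verts d"
    using assms by (auto simp: circuit_def)
  let ?x = "C ! (i mod ?N)" and ?y = "C ! (Suc (Suc i) mod ?N)"
  have lt: "j mod ?N < ?N" for j
    using N by (intro mod_less_divisor) auto
  have len: "length ?x = d" "length ?y = d"
    using C(2) lt by (auto simp: cube_verts_def subset_iff)
  have "support ?x = support ?y"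
    using support_transition[OF assms, of i] support_transition[OF assms, of "Suc i"] eq by auto
  then have "{p. p < length ?x \<and> ?x ! p \<noteq> ?y ! p} = {}"
    using sym_diff_support[of ?x ?y] len by simp
  then have "?x = ?y"
    using len by (auto intro: nth_equalityI)
  then have "i mod ?N = Suc (Suc i) mod ?N"
    using C(1) lt by (simp add: nth_eq_iff_index_eq)
  then have "?N dvd 2"
    using mod_eq_dvd_iff_nat[of i "Suc (Suc i)" ?N] by (simp add: numeral_2_eq_2)
  then show False
    using N by (auto dest: dvd_imp_le)
qed

text \<open>Restates a bit run on unrolled indices: \<open>s\<close> is the rotation that brings a
  longest run to the front, and its first \<open>r\<close> transitions are kept.\<close>

lemma max_bit_run_inj:
  assumes "max_bit_run C \<ge> r" "length C > 0"
  obtains s where "inj_on (\<lambda>i. transition_seq C ! (i mod length C)) {s..<s + r}"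
proof -
  let ?T = "transition_seq C"
  let ?S = "{length s |s. s \<in> segments ?T \<and> distinct s}"
  have "?S \<subseteq> {..length C}"
    by (auto simp: segments_def)
  then have "finite ?S"
    using finite_subset by blast
  \<comment> \<open>The empty segment makes the set nonempty, so that \<open>Max\<close> is
    attained.\<close>
  moreover have "[] \<in> segments ?T"
    by (auto simp: segments_def intro!: exI[of _ 0])
  then have "?S \<noteq> {}"
    by (auto intro: exI[of _ "[]"])
  ultimately have "max_bit_run C \<in> ?S"
    unfolding max_bit_run_def by (rule Max_in)
  then obtain s m where s: "distinct (take m (rotate s ?T))" "m \<le> length C" "max_bit_run C = m"
    by (auto simp: segments_def)
  have nth: "take m (rotate s ?T) ! (i - s) = ?T ! (i mod length C)" if "i \<in> {s..<s + r}" for i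
  proof -
    have "i - s < m" "s + (i - s) = i"
      using that s(3) assms(1) by auto
    then show ?thesis
      using s(2) by (simp add: nth_rotate)
  qed
  have "inj_on (\<lambda>i. ?T ! (i mod length C)) {s..<s + r}"
  proof (rule inj_onI)
    fix i j
    assume ij: "i \<in> {s..<s + r}" "j \<in> {s..<s + r}"
      and eq: "?T ! (i mod length C) = ?T ! (j mod length C)"
    have "take m (rotate s ?T) ! (i - s) = take m (rotate s ?T) ! (j - s)"
      using nth[OF ij(1)] nth[OF ij(2)] eq by (simp only:)
    then have "i - s = j - s"
      using s ij assms(1) by (subst (asm) nth_eq_iff_index_eq) auto
    with ij show "i = j" by (simp add: eq_diff_iff)
  qed
  then show thesis by (rule that)
qed

theorem lemma3p7:
  fixes k l d :: nat and C :: "bool list list"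
  assumes "odd k"
    and "even l"
    and "l \<ge> 2"
    and "k \<ge> 2 * l + 1"
    and "real d = 3 * real k / 2 + (real l + 1) / 2"
    and "C \<in> circuit_codes d k (k + l)"
    and "symmetric_code C"
  shows "length C \<le> 4 * k + 2 * l"
proof -
  have code: "circuit_code d k C" and run: "max_bit_run C \<ge> k + l"
    using assms(6) by (auto simp: circuit_codes_def)
  then have circ: "circuit d C"
    by (simp add: circuit_code_def)
  then have C: "length C > 0" "set C \<subseteq> cube_verts d"
    by (auto simp: circuit_def)
  obtain n where n: "length C = 2 * n"
    using even_length_circuit[OF circ] by blast
  obtain s where s: "inj_on (\<lambda>i. transition_seq C ! (i mod length C)) {s..<s + (k + l)}"
    using max_bit_run_inj[OF run C(1)] .
  have "n \<le> 2 * k + l"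
  proof (rule antipodal_walk_bound)
    show "support (C ! (i mod length C)) \<subseteq> {..<d}" for i
      using C by (auto simp: support_def cube_verts_def subset_iff)
    show "transition_seq C ! ((i + n) mod length C) = transition_seq C ! (i mod length C)" for i
    proof -
      have sym: "transition_seq C ! j = transition_seq C ! (j + n)" if "j < n" for j
        using assms(7) that n by (simp add: symmetric_code_def)
      define j where "j = i mod (2 * n)"
      have "j < 2 * n"
        using C n by (simp add: j_def)
      have "(i + n) mod (2 * n) = (j + n) mod (2 * n)"
        by (simp add: j_def mod_simps)
      \<comment> \<open>Symmetry is given on the first half only; from the second half
        \<open>j + n\<close> wraps to \<open>j - n\<close>, where it applies in reverse.\<close>
      also have "\<dots> = (if j < n then j + n else j - n)"
        using \<open>j < 2 * n\<close> by (simp add: mod_if)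
      finally show ?thesis
        using sym[of j] sym[of "j - n"] \<open>j < 2 * n\<close> by (simp add: n j_def[symmetric])
    qed
    have "2 * real d = 3 * real k + real l + 1"
      using assms(5) by (simp add: field_simps)
    then show "2 * d = 3 * k + l + 1"
      by linarith
    show "k \<ge> 1"
      using assms(4) by simp
  qed (use s support_transition[OF circ] transition_seq_turn[OF circ] circuit_code_far[OF code] n
      in simp_all)
  with n show ?thesis by simp
qed

end
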